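(* Let $\mu\preceq_{\mathrm{st}}\nu$ be atomless Borel probability measures on $\mathbb{R}$ with $\mu\wedge\nu=0$ (i.e. $\mu,\nu$ are mutually singular). Then $P_*=P_*(\mu,\nu)$ is of Monge-type, with transport map $T$ given by $$T(x)=\inf\{y\ge x:\ (y,F(x))\notin H\}$$ (with $\inf\emptyset=\infty$) for the function $F=F_\mu-F_\nu$ and its hypograph $H=\{(x,z)\in\mathbb{R}^2:\ z\le F(x)\}$.
   Context: For finite Borel measures $\theta_1,\theta_2$ on $\mathbb{R}$ with cdf's $F_{\theta_i}(t)=\theta_i((-\infty,t])$, $\theta_1\preceq_{\mathrm{st}}\theta_2$ means $\theta_1(\mathbb{R})=\theta_2(\mathbb{R})$ and $F_{\theta_1}\ge F_{\theta_2}$; $\theta_1\le\theta_2$ means $\theta_1(A)\le\theta_2(A)$ for all Borel $A$. $\mu\wedge\nu$ is the maximal measure $\theta$ with $\theta\le\mu$ and $\theta\le\nu$. A directional coupling of $\mu,\nu$ is a probability measure on $\mathbb{R}^2$ with first marginal $\mu$ and second marginal $\nu$ concentrated on $\mathbb{H}=\{(x,y):y\ge x\}$. $P_*(\mu,\nu)$ denotes the optimal directional coupling: the unique directional coupling $P$ of $\mu,\nu$ such that $P((x,\infty)\times\cdot)=\nu_x$ for all $x\in\mathbb{R}$, where $\nu_x$ is the unique minimal element for $\preceq_{\mathrm{st}}$ of $\{\theta:\mu|_{(x,\infty)}\preceq_{\mathrm{st}}\theta\le\nu\}$ (equivalently, $F_{\nu_x}$ is the supremum of $F_\theta$ over this set).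 Existence and uniqueness hold whenever $\mu\preceq_{\mathrm{st}}\nu$. A coupling $P$ is of Monge-type with transport map $T$ if $P=\mu\otimes\kappa$ with a stochastic kernel $\kappa$ satisfying $\kappa(x,dy)=\delta_{T(x)}(dy)$ for $\mu$-a.e. $x$ (in particular $T<\infty$ $\mu$-a.e.). *)

theory Defs
  imports "HOL-Probability.Probability"
begin

text \<open>
  Finite Borel measures on the line are the library's \<^const>\<open>finite_borel_measure\<close>, and Borel
  probability measures on the line its \<^const>\<open>real_distribution\<close>.  For measures on the same
  sigma-algebra the library order \<open>\<le>\<close> on measures is the setwise one, and the lattice infimum
  \<^const>\<open>inf\<close> is the maximal measure below both arguments:
\<close>

lemma borel_measure_le_iff:
  fixes \<theta> \<nu> :: "real measure"
  assumes "sets \<theta> = sets borel" "sets \<nu> = sets borel"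
  shows "\<theta> \<le> \<nu> \<longleftrightarrow> (\<forall>A\<in>sets borel. emeasure \<theta> A \<le> emeasure \<nu> A)"
  using assms by (simp add: le_measure)

lemma sets_inf_borel_measure:
  fixes \<mu> \<nu> :: "real measure"
  assumes "sets \<mu> = sets borel" "sets \<nu> = sets borel"
  shows "sets (inf \<mu> \<nu>) = sets borel"
proof -
  have sp: "space \<mu> = UNIV" "space \<nu> = UNIV"
    using assms by (auto dest: sets_eq_imp_space_eq)
  have "null_measure borel \<le> \<mu>" "null_measure borel \<le> \<nu>"
    using assms by (simp_all add: le_measure)
  then have l: "null_measure borel \<le> inf \<mu> \<nu>" by simp
  have u: "inf \<mu> \<nu> \<le> \<mu>" by simp
  show ?thesis
    using l u assms sp by (auto simp: le_measure_iff split: if_splits)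
qed

lemma le_inf_borel_measure_iff:
  fixes \<mu> \<nu> \<theta> :: "real measure"
  shows "\<theta> \<le> inf \<mu> \<nu> \<longleftrightarrow> \<theta> \<le> \<mu> \<and> \<theta> \<le> \<nu>"
  by simp

definition st_le :: "real measure \<Rightarrow> real measure \<Rightarrow> bool" (infix "\<preceq>\<^sub>s\<^sub>t" 50) where
  "\<theta>\<^sub>1 \<preceq>\<^sub>s\<^sub>t \<theta>\<^sub>2 \<longleftrightarrow>
     emeasure \<theta>\<^sub>1 UNIV = emeasure \<theta>\<^sub>2 UNIV \<and> (\<forall>t. cdf \<theta>\<^sub>2 t \<le> cdf \<theta>\<^sub>1 t)"

text \<open>The restriction keeps the whole line as its space, unlike \<^const>\<open>restrict_space\<close>.\<close>

definition restrict_to :: "real measure \<Rightarrow> real set \<Rightarrow> real measure" where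
  "restrict_to \<mu> A = density \<mu> (indicator A)"

definition atomless :: "real measure \<Rightarrow> bool" where
  "atomless \<mu> \<longleftrightarrow> (\<forall>x. emeasure \<mu> {x} = 0)"

definition coupling :: "real measure \<Rightarrow> real measure \<Rightarrow> (real \<times> real) measure \<Rightarrow> bool" where
  "coupling \<mu> \<nu> P \<longleftrightarrow>
     prob_space P \<and> sets P = sets borel \<and> distr P borel fst = \<mu> \<and> distr P borel snd = \<nu>"

definition directional_coupling ::
    "real measure \<Rightarrow> real measure \<Rightarrow> (real \<times> real) measure \<Rightarrow> bool" where
  "directional_coupling \<mu> \<nu> P \<longleftrightarrow> coupling \<mu> \<nu> P \<and> (AE (x, y) in P. y \<ge> x)"

definition admissible_targets :: "real measure \<Rightarrow> real measure \<Rightarrow> real \<Rightarrow> real measure set" where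
  "admissible_targets \<mu> \<nu> x =
     {\<theta>. finite_borel_measure \<theta> \<and> restrict_to \<mu> {x<..} \<preceq>\<^sub>s\<^sub>t \<theta> \<and> \<theta> \<le> \<nu>}"

definition optimal_target :: "real measure \<Rightarrow> real measure \<Rightarrow> real \<Rightarrow> real measure" where
  "optimal_target \<mu> \<nu> x =
     (THE \<theta>. \<theta> \<in> admissible_targets \<mu> \<nu> x \<and>
        (\<forall>\<theta>'\<in>admissible_targets \<mu> \<nu> x. \<theta>' \<preceq>\<^sub>s\<^sub>t \<theta> \<longrightarrow> \<theta>' = \<theta>))"

definition P_star :: "real measure \<Rightarrow> real measure \<Rightarrow> (real \<times> real) measure" where
  "P_star \<mu> \<nu> =
     (THE P. directional_coupling \<mu> \<nu> P \<and>
        (\<forall>x. \<forall>B\<in>sets borel. emeasure P ({x<..} \<times> B) = emeasure (optimal_target \<mu> \<nu> x) B))"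

text \<open>
  The measure \<open>\<mu> \<otimes> \<kappa>\<close> on the plane, \<open>A \<mapsto> \<integral> \<kappa>(x, {y. (x, y) \<in> A}) \<mu>(dx)\<close>:
  the Giry-monad bind averages over \<open>\<mu>\<close> the image of \<open>\<kappa>(x, \<cdot>)\<close> under \<open>y \<mapsto> (x, y)\<close>.
\<close>

definition kernel_product ::
    "real measure \<Rightarrow> (real \<Rightarrow> real measure) \<Rightarrow> (real \<times> real) measure" where
  "kernel_product \<mu> \<kappa> = \<mu> \<bind> (\<lambda>x. distr (\<kappa> x) borel (Pair x))"

text \<open>
  A stochastic kernel is a measurable map into \<^const>\<open>prob_algebra\<close>.  The map \<open>T\<close> may take
  infinite values, but only on a \<open>\<mu>\<close>-null set.
\<close>

definition monge_type ::
    "real measure \<Rightarrow> real measure \<Rightarrow> (real \<times> real) measure \<Rightarrow> (real \<Rightarrow> ereal) \<Rightarrow> bool" where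
  "monge_type \<mu> \<nu> P T \<longleftrightarrow> coupling \<mu> \<nu> P \<and>
     (\<exists>\<kappa> \<in> borel \<rightarrow>\<^sub>M prob_algebra borel.
        P = kernel_product \<mu> \<kappa> \<and>
        (AE x in \<mu>. \<exists>y. T x = ereal y \<and> \<kappa> x = return borel y))"

definition cdf_diff :: "real measure \<Rightarrow> real measure \<Rightarrow> real \<Rightarrow> real" where
  "cdf_diff \<mu> \<nu> x = cdf \<mu> x - cdf \<nu> x"

definition hypograph :: "(real \<Rightarrow> real) \<Rightarrow> (real \<times> real) set" where
  "hypograph F = {(x, z). z \<le> F x}"

text \<open>The infimum is taken in \<^typ>\<open>ereal\<close>, so that it is \<open>\<infinity>\<close> for the empty set.\<close>

definition transport_map :: "(real \<Rightarrow> real) \<Rightarrow> real \<Rightarrow> ereal" where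
  "transport_map F x = Inf (ereal ` {y. y \<ge> x \<and> (y, F x) \<notin> hypograph F})"

end

theory Submission
  imports Defs
begin

text \<open>
  Read \<open>F = F\<^sub>\<mu> - F\<^sub>\<nu>\<close> as the mass that has to be carried across a point.  The map \<open>T\<close> moves \<open>t\<close> to the
  first place after which \<open>F\<close> gets below its value at \<open>t\<close>; by continuity \<open>T t \<ge> y\<close> holds for \<open>t < y\<close>
  exactly when \<open>F \<ge> F t\<close> on \<open>[t, y]\<close>.  Call the set of these \<open>t \<le> y\<close> the future minima \<open>A y\<close>.

  Everything rests on computing \<open>\<mu> (A y \<inter> [x, y])\<close>, the mass that starts in \<open>[x, y]\<close> and is still
  travelling at \<open>y\<close>.  The set \<open>A y\<close> is closed, and \<open>F\<close> takes equal values at the two ends of each gap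
  of it (\<open>gap_endpoints_eq\<close>), so \<open>\<mu>\<close> and \<open>\<nu>\<close> agree on the gaps.  Hence the charge \<open>\<mu> - \<nu>\<close> of
  \<open>A y \<inter> [s, t]\<close>, if that set is nonempty, is the increment of \<open>F\<close> between its extreme points
  (\<open>charge_of_future_minima\<close>).
  Since \<open>F\<close> is nondecreasing along \<open>A y\<close>, this gives \<open>\<nu> \<le> \<mu>\<close> on \<open>A y\<close>, and mutual singularity forces
  \<open>\<nu> (A y) = 0\<close> (\<open>nu_future_minima\<close>).  So \<open>\<mu> (A y \<inter> [x, y]) = F y - m\<close>, where \<open>m\<close> is the minimum of
  \<open>F\<close> on \<open>[x, y]\<close> (\<open>mu_future_minima\<close>).

  Consequently the image \<open>\<theta>\<close> of \<open>\<mu>\<close> restricted to \<open>(x, \<infinity>)\<close> under \<open>T\<close> satisfies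
  \<open>\<theta> (-\<infinity>, y) = F\<^sub>\<nu> y - F\<^sub>\<mu> x + m\<close> for \<open>y \<ge> x\<close>.  As \<open>m\<close> is nonincreasing in \<open>y\<close>, \<open>\<theta>\<close> is at most \<open>\<nu>\<close> on
  intervals, hence as a measure.  A competitor \<open>\<theta>'\<close> satisfies, for each \<open>p\<close> in \<open>[x, y]\<close>,
  \<open>F\<^bsub>\<theta>'\<^esub> y \<le> \<mu> (x, p] + \<nu> (p, y] = F\<^sub>\<nu> y - F\<^sub>\<mu> x + F p\<close>, because up to \<open>p\<close> it is limited by the supply
  from \<open>\<mu>\<close> and after \<open>p\<close> by the capacity \<open>\<nu>\<close>; minimising over \<open>p\<close> shows that \<open>\<theta>\<close> is the least
  competitor (\<open>target_least\<close>).  The coupling carried by the graph of \<open>T\<close> therefore has the tails that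
  characterise \<open>P\<^sub>*\<close>, and these tails determine a measure on the plane (\<open>P_star_eqI\<close>).
\<close>

section \<open>Comparing measures on the line\<close>

lemma finite_borel_measureI:
  fixes M :: "real measure"
  assumes "sets M = sets borel" "emeasure M UNIV \<noteq> \<infinity>"
  shows "finite_borel_measure M"
proof -
  have "space M = UNIV"
    using sets_eq_imp_space_eq[OF assms(1)] by simp
  then have "finite_measure M"
    using assms(2) by (intro finite_measureI) simp
  then show ?thesis
    using assms(1) by (simp add: finite_borel_measure_def finite_borel_measure_axioms_def)
qed

text \<open>
  The difference of the two distribution functions is itself the distribution function of a measure
  \<open>L\<close>, and \<open>N + L = M\<close> by uniqueness.
\<close>

lemma le_measure_if_Ioc_le:
  fixes M N :: "real measure"
  assumes M: "finite_borel_measure M" and N: "finite_borel_measure N"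
    and le: "\<And>s t. s < t \<Longrightarrow> measure N {s<..t} \<le> measure M {s<..t}"
  shows "N \<le> M"
proof -
  interpret M: finite_borel_measure M by fact
  interpret N: finite_borel_measure N by fact
  note [simp, measurable_cong] = M.M_is_borel N.M_is_borel
  define h where "h x = cdf M x - cdf N x" for x
  have mono: "h x \<le> h y" if "x \<le> y" for x y
    using that le[of x y] M.cdf_diff_eq[of x y] N.cdf_diff_eq[of x y]
    by (cases "x = y") (auto simp: h_def)
  have rcont: "continuous (at_right a) h" for a
    unfolding h_def by (intro continuous_intros M.cdf_is_right_cont N.cdf_is_right_cont)
  have bot: "(h \<longlongrightarrow> 0) at_bot"
    using tendsto_diff[OF M.cdf_lim_at_bot N.cdf_lim_at_bot] by (simp add: h_def[abs_def])
  define m where "m = measure M (space M) - measure N (space N)"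
  have top: "(h \<longlongrightarrow> m) at_top"
    unfolding h_def m_def by (intro tendsto_diff M.cdf_lim_at_top N.cdf_lim_at_top)
  have h_nonneg: "0 \<le> h x" for x
    by (rule tendsto_upperbound[OF bot])
       (auto intro!: exI[of _ x] mono simp: eventually_at_bot_linorder)
  have m: "0 \<le> m"
    by (rule tendsto_lowerbound[OF top]) (auto simp: h_nonneg)
  define L where "L = interval_measure h"
  interpret L: finite_borel_measure L
    unfolding L_def by (rule finite_borel_measure_interval_measure[OF mono rcont bot top m])
  note [simp, measurable_cong] = L.M_is_borel
  have cdf_L: "cdf L = h"
    unfolding L_def by (rule cdf_interval_measure[OF mono rcont bot])
  define K where "K = measure_of UNIV (sets borel) (\<lambda>A. emeasure N A + emeasure L A)"
  have sets_K: "sets K = sets borel"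
    unfolding K_def by (metis sets.sets_measure_of_eq space_borel)
  have K: "emeasure K A = emeasure N A + emeasure L A" if "A \<in> sets borel" for A
    unfolding K_def
  proof (rule emeasure_measure_of_sigma)
    show "sigma_algebra UNIV (sets (borel :: real measure))"
      using sets.sigma_algebra_axioms[of borel] by simp
    show "positive (sets borel) (\<lambda>A. emeasure N A + emeasure L A)"
      by (simp add: positive_def)
    show "countably_additive (sets borel) (\<lambda>A. emeasure N A + emeasure L A)"
    proof (rule countably_additiveI)
      fix B :: "nat \<Rightarrow> real set"
      assume B: "range B \<subseteq> sets borel" "disjoint_family B"
      have "(\<Sum>i. emeasure N (B i) + emeasure L (B i)) = (\<Sum>i. emeasure N (B i)) + (\<Sum>i. emeasure L (B i))"
        by (intro suminf_add[symmetric] summableI)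
      also have "\<dots> = emeasure N (\<Union>i. B i) + emeasure L (\<Union>i. B i)"
        using B by (simp only: suminf_emeasure N.M_is_borel L.M_is_borel)
      finally show "(\<Sum>i. emeasure N (B i) + emeasure L (B i))
          = emeasure N (\<Union>i. B i) + emeasure L (\<Union>i. B i)" .
    qed
  qed (use that in auto)
  have "finite_borel_measure K"
    by (rule finite_borel_measureI[OF sets_K])
       (simp add: K N.emeasure_eq_measure L.emeasure_eq_measure)
  moreover have "cdf K = cdf M"
  proof
    fix x
    have "emeasure K {..x} = emeasure N {..x} + emeasure L {..x}"
      by (rule K) simp
    also have "\<dots> = ennreal (cdf N x + cdf L x)"
      by (simp only: N.emeasure_eq_measure L.emeasure_eq_measure cdf_def2 ennreal_plus measure_nonneg)
    also have "cdf N x + cdf L x = cdf M x"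
      by (simp add: cdf_L h_def)
    finally show "cdf K x = cdf M x"
      by (simp only: cdf_def2[of K] measure_def enn2real_ennreal M.cdf_nonneg)
  qed
  ultimately have "K = M"
    by (intro cdf_unique' M)
  then have "emeasure N A \<le> emeasure M A" if "A \<in> sets borel" for A
    using K[OF that] by auto
  then show ?thesis
    by (simp add: borel_measure_le_iff)
qed

text \<open>
  The complement of a closed set between two of its points is a disjoint union of gaps, and these
  are countably many because they are open.
\<close>

lemma emeasure_gaps_eq:
  fixes A :: "real set" and M N :: "real measure"
  assumes [simp]: "sets M = sets borel" "sets N = sets borel"
    and A: "closed A" and st: "s \<in> A" "t \<in> A"
    and gap: "\<And>a b. a \<in> A \<Longrightarrow> b \<in> A \<Longrightarrow> a < b \<Longrightarrow> {a<..<b} \<inter> A = {}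
      \<Longrightarrow> emeasure M {a<..<b} = emeasure N {a<..<b}"
  shows "emeasure M ({s..t} - A) = emeasure N ({s..t} - A)"
proof -
  define G where "G = {{a<..<b} | a b. a \<in> A \<and> b \<in> A \<and> s \<le> a \<and> a < b \<and> b \<le> t \<and> {a<..<b} \<inter> A = {}}"
  have disj: "pairwise disjnt G"
  proof (rule pairwiseI)
    fix C D assume "C \<in> G" "D \<in> G" "C \<noteq> D"
    then obtain a b c d where C: "C = {a<..<b}" "a \<in> A" "b \<in> A" "{a<..<b} \<inter> A = {}"
      and D: "D = {c<..<d}" "c \<in> A" "d \<in> A" "{c<..<d} \<inter> A = {}"
      unfolding G_def by blast
    show "disjnt C D"
    proof (rule ccontr)
      assume "\<not> disjnt C D"
      then obtain z where "a < z" "z < b" "c < z" "z < d"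
        by (auto simp: disjnt_iff C D)
      then have "c \<le> a" "a \<le> c" "b \<le> d" "d \<le> b"
        using C D by (force simp: disjoint_iff)+
      then show False using C D \<open>C \<noteq> D\<close> by auto
    qed
  qed
  have op: "open C" if "C \<in> G" for C
    using that by (auto simp: G_def)
  have cnt: "countable G"
    by (rule countable_disjoint_open_subsets[OF op disj])
  have fam: "disjoint_family_on (\<lambda>C. C) G"
    using disj by (auto simp: disjoint_family_on_def pairwise_def disjnt_def)
  have Un: "{s..t} - A = \<Union>((\<lambda>C. C) ` G)"
  proof (intro equalityI subsetI)
    fix u assume u: "u \<in> {s..t} - A"
    define a b where "a = Sup (A \<inter> {s..u})" and "b = Inf (A \<inter> {u..t})"
    have a: "a \<in> A \<inter> {s..u}"
      unfolding a_def using u st A by (intro closed_contains_Sup) (auto intro!: closed_Int)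
    have b: "b \<in> A \<inter> {u..t}"
      unfolding b_def using u st A by (intro closed_contains_Inf) (auto intro!: closed_Int)
    have "v \<le> a" if "v \<in> A \<inter> {s..u}" for v
      unfolding a_def using that by (intro cSup_upper) auto
    moreover have "b \<le> v" if "v \<in> A \<inter> {u..t}" for v
      unfolding b_def using that by (intro cInf_lower) auto
    ultimately have "{a<..<b} \<inter> A = {}"
      using a b by (force simp: disjoint_iff)
    moreover have "a < u" "u < b"
      using a b u by (auto simp: less_le)
    ultimately have "{a<..<b} \<in> G"
      using a b unfolding G_def mem_Collect_eq by (intro exI[of _ a] exI[of _ b]) simp
    then show "u \<in> \<Union>((\<lambda>C. C) ` G)"
      using \<open>a < u\<close> \<open>u < b\<close> by (auto intro!: bexI[of _ "{a<..<b}"])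
  qed (auto simp: G_def)
  have "emeasure M ({s..t} - A) = (\<integral>\<^sup>+C. emeasure M C \<partial>count_space G)"
    unfolding Un using op by (intro emeasure_UN_countable cnt fam) auto
  also have "\<dots> = (\<integral>\<^sup>+C. emeasure N C \<partial>count_space G)"
    by (intro nn_integral_cong) (auto simp: G_def gap)
  also have "\<dots> = emeasure N ({s..t} - A)"
    unfolding Un using op by (intro emeasure_UN_countable[symmetric] cnt fam) auto
  finally show ?thesis .
qed

section \<open>Future minima of a continuous function\<close>

definition future_minima :: "(real \<Rightarrow> real) \<Rightarrow> real \<Rightarrow> real set" where
  "future_minima F y = {t. t \<le> y \<and> (\<forall>s\<in>{t..y}. F t \<le> F s)}"

definition run_min :: "(real \<Rightarrow> real) \<Rightarrow> real \<Rightarrow> real \<Rightarrow> real" where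
  "run_min F x y = Inf (F ` {x..y})"

text \<open>
  Parametrising the points of \<open>[t, y]\<close> as \<open>min (t + r) y\<close> removes the dependence of the quantifier
  range on \<open>t\<close> and presents the set as an intersection of closed ones.
\<close>

lemma closed_future_minima:
  assumes "continuous_on UNIV F"
  shows "closed (future_minima F y)"
proof -
  have "future_minima F y = {..y} \<inter> (\<Inter>r\<in>{0..}. {t. F t \<le> F (min (t + r) y)})"
  proof (intro equalityI subsetI)
    fix t assume t: "t \<in> {..y} \<inter> (\<Inter>r\<in>{0..}. {t. F t \<le> F (min (t + r) y)})"
    have "F t \<le> F s" if "s \<in> {t..y}" for s
    proof -
      have "s - t \<in> {0..}" using that by simp
      with t have "F t \<le> F (min (t + (s - t)) y)" by blast
      with that show ?thesis by (simp add: min_def)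
    qed
    with t show "t \<in> future_minima F y" by (auto simp: future_minima_def)
  qed (auto simp: future_minima_def)
  moreover have "closed {t. F t \<le> F (min (t + r) y)}" for r
    by (intro closed_Collect_le continuous_intros continuous_on_compose2[OF assms] assms) auto
  ultimately show ?thesis by (simp add: closed_Int closed_INT)
qed

lemma run_min_attained:
  assumes "continuous_on UNIV F" "x \<le> y"
  shows "\<exists>p\<in>{x..y} \<inter> future_minima F y. run_min F x y = F p"
proof -
  have "\<exists>p\<in>{x..y}. \<forall>q\<in>{x..y}. F p \<le> F q"
    using assms by (intro continuous_attains_inf) (auto intro: continuous_on_subset)
  then obtain p where p: "p \<in> {x..y}" "\<And>q. q \<in> {x..y} \<Longrightarrow> F p \<le> F q" by blast
  have "run_min F x y = F p"
    unfolding run_min_def using p by (intro cInf_eq_minimum) auto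
  moreover have "p \<in> future_minima F y"
    using p by (auto simp: future_minima_def)
  ultimately show ?thesis using p(1) by blast
qed

lemma run_min_le:
  assumes "continuous_on UNIV F" "p \<in> {x..y}"
  shows "run_min F x y \<le> F p"
  unfolding run_min_def using assms
  by (intro cInf_lower bounded_imp_bdd_below compact_imp_bounded compact_continuous_image)
     (auto intro: continuous_on_subset)

lemma run_min_antimono:
  assumes "continuous_on UNIV F" "x \<le> y" "y \<le> z"
  shows "run_min F x z \<le> run_min F x y"
proof -
  obtain p where "p \<in> {x..y}" "run_min F x y = F p"
    using run_min_attained[OF assms(1,2)] by blast
  then show ?thesis using run_min_le[OF assms(1), of p x z] assms(3) by auto
qed

text \<open>
  The minimum over an interval ending at \<open>y\<close> is attained at a future minimum, and \<open>F\<close> is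
  nondecreasing along future minima, so the first one available realises it.
\<close>

lemma run_min_eq_first_future_minimum:
  assumes "continuous_on UNIV F" "x \<le> p" "p \<in> future_minima F y" "{x..<p} \<inter> future_minima F y = {}"
  shows "run_min F x y = F p"
proof -
  have "p \<le> y" using assms by (auto simp: future_minima_def)
  then obtain q where q: "q \<in> {x..y} \<inter> future_minima F y" "run_min F x y = F q"
    using run_min_attained[OF assms(1), of x y] assms(2) by auto
  with assms(4) have "q \<in> {p..y}" by (auto simp: disjoint_iff)
  then have "F p \<le> F q" using assms(3) by (auto simp: future_minima_def)
  moreover have "run_min F x y \<le> F p"
    using \<open>p \<le> y\<close> assms by (intro run_min_le) auto
  ultimately show ?thesis using q by simp
qed

text \<open>
  Inside a gap the next future minimum is \<open>b\<close>, which makes \<open>F b\<close> the minimum of \<open>F\<close> over \<open>[c, y]\<close> for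
  each \<open>c\<close> in the gap; letting \<open>c\<close> decrease to \<open>a\<close> gives \<open>F b \<le> F a\<close>.
\<close>

lemma gap_endpoints_eq:
  assumes F: "continuous_on UNIV F" and a: "a \<in> future_minima F y" and b: "b \<in> future_minima F y"
    and "a < b" and gap: "{a<..<b} \<inter> future_minima F y = {}"
  shows "F a = F b"
proof (rule antisym)
  show "F a \<le> F b" using a b \<open>a < b\<close> by (auto simp: future_minima_def)
  have "F b \<le> F c" if "c \<in> {a<..<b}" for c
  proof -
    have "run_min F c y = F b"
      using that gap by (intro run_min_eq_first_future_minimum F b) (auto simp: disjoint_iff)
    moreover have "run_min F c y \<le> F c"
      using that b by (intro run_min_le F) (auto simp: future_minima_def)
    ultimately show ?thesis by simp
  qed
  then have "\<forall>\<^sub>F c in at_right a. F b \<le> F c"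
    using \<open>a < b\<close> by (auto simp: eventually_at_right)
  moreover have "(F \<longlongrightarrow> F a) (at_right a)"
    using F by (auto simp: continuous_on_def intro: tendsto_within_subset)
  ultimately show "F b \<le> F a"
    by (intro tendsto_lowerbound) auto
qed

text \<open>
  Directly from the infimum, \<open>F \<ge> F t\<close> only follows on \<open>[t, y)\<close>; continuity adds the point \<open>y\<close>.
\<close>

lemma le_transport_map_iff:
  assumes F: "continuous_on UNIV F"
  shows "ereal y \<le> transport_map F t \<longleftrightarrow> y \<le> t \<or> t \<in> future_minima F y"
proof -
  have *: "ereal y \<le> transport_map F t \<longleftrightarrow> (\<forall>z\<ge>t. z < y \<longrightarrow> F t \<le> F z)"
    by (auto simp: transport_map_def hypograph_def le_Inf_iff not_le[symmetric])
  show ?thesis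
  proof (cases "t < y")
    case True
    have "F t \<le> F y" if "\<forall>z\<ge>t. z < y \<longrightarrow> F t \<le> F z"
    proof (rule tendsto_lowerbound)
      show "(F \<longlongrightarrow> F y) (at_left y)"
        using F by (auto simp: continuous_on_def intro: tendsto_within_subset)
      show "\<forall>\<^sub>F z in at_left y. F t \<le> F z"
        using True that by (auto simp: eventually_at_left intro!: exI[of _ t])
    qed auto
    then show ?thesis
      using True by (auto simp: * future_minima_def) (metis less_eq_real_def)
  qed (auto simp: *)
qed

lemma transport_map_ge: "ereal t \<le> transport_map F t"
  by (auto simp: transport_map_def le_Inf_iff)

lemma measurable_transport_map:
  assumes "continuous_on UNIV F"
  shows "transport_map F \<in> borel_measurable borel"
proof -
  have "transport_map F -` {a..} \<in> sets borel" for a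
  proof (cases a)
    case (real y)
    have "transport_map F -` {a..} = {y..} \<union> future_minima F y"
      by (auto simp: real le_transport_map_iff[OF assms])
    then show ?thesis
      using closed_future_minima[OF assms, of y] by auto
  next
    case PInf
    have "transport_map F -` {a..} = (\<Inter>n::nat. {real n..} \<union> future_minima F (real n))"
    proof (intro equalityI subsetI)
      fix t assume "t \<in> (\<Inter>n::nat. {real n..} \<union> future_minima F (real n))"
      then have "ereal (real n) \<le> transport_map F t" for n
        by (auto simp: le_transport_map_iff[OF assms])
      then have "transport_map F t = \<infinity>"
        by (intro ereal_top) (meson ereal_less_eq(3) order_trans real_arch_simple)
      then show "t \<in> transport_map F -` {a..}" by (simp add: PInf)
    next
      fix t assume "t \<in> transport_map F -` {a..}"
      then have "ereal (real n) \<le> transport_map F t" for n by (simp add: PInf)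
      then show "t \<in> (\<Inter>n::nat. {real n..} \<union> future_minima F (real n))"
        by (auto simp: le_transport_map_iff[OF assms])
    qed
    moreover have "future_minima F (real n) \<in> sets borel" for n
      using closed_future_minima[OF assms] by (rule borel_closed)
    ultimately show ?thesis by auto
  next
    case MInf
    then have "transport_map F -` {a..} = UNIV" by auto
    then show ?thesis by simp
  qed
  then show ?thesis
    by (subst borel_measurable_iff_Ici_ereal) auto
qed

section \<open>Characterising the optimal targets and the optimal coupling\<close>

lemma emeasure_restrict_to:
  assumes "sets M = sets borel" "A \<in> sets borel" "B \<in> sets borel"
  shows "emeasure (restrict_to M A) B = emeasure M (A \<inter> B)"
  unfolding restrict_to_def using assms by (intro emeasure_restricted) auto

lemma sets_restrict_to [simp, measurable_cong]: "sets (restrict_to M A) = sets M"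
  by (simp add: restrict_to_def)

lemma space_restrict_to [simp]: "space (restrict_to M A) = space M"
  by (simp add: restrict_to_def)

lemma finite_borel_measure_restrict_to:
  assumes "finite_borel_measure M" "A \<in> sets borel"
  shows "finite_borel_measure (restrict_to M A)"
proof -
  interpret finite_borel_measure M by fact
  show ?thesis
    by (rule finite_borel_measureI)
       (auto simp: M_is_borel emeasure_restrict_to assms emeasure_eq_measure)
qed

lemma measure_restrict_to:
  assumes "sets M = sets borel" "A \<in> sets borel" "B \<in> sets borel"
  shows "measure (restrict_to M A) B = measure M (A \<inter> B)"
  using emeasure_restrict_to[OF assms] by (simp add: measure_def)

lemma restrict_to_le:
  assumes "sets M = sets borel" "A \<in> sets borel"
  shows "restrict_to M A \<le> M"
  using assms by (auto simp: borel_measure_le_iff emeasure_restrict_to intro!: emeasure_mono)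

text \<open>
  A least element is the only minimal one: a minimal \<open>\<theta>'\<close> lies above it, hence equals it.
  Antisymmetry of the order comes from the fact that a distribution function determines its measure.
\<close>

lemma optimal_target_eqI:
  assumes \<theta>: "\<theta> \<in> admissible_targets \<mu> \<nu> x"
    and least: "\<And>\<theta>'. \<theta>' \<in> admissible_targets \<mu> \<nu> x \<Longrightarrow> \<theta> \<preceq>\<^sub>s\<^sub>t \<theta>'"
  shows "optimal_target \<mu> \<nu> x = \<theta>"
  unfolding optimal_target_def
proof (rule the_equality)
  have "\<theta>' = \<theta>" if "\<theta>' \<in> admissible_targets \<mu> \<nu> x" "\<theta>' \<preceq>\<^sub>s\<^sub>t \<theta>" for \<theta>'
  proof (rule cdf_unique')
    show "cdf \<theta>' = cdf \<theta>"
      using least[OF that(1)] that(2) by (auto simp: st_le_def intro!: ext antisym)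
  qed (use \<theta> that in \<open>auto simp: admissible_targets_def\<close>)
  then show "\<theta> \<in> admissible_targets \<mu> \<nu> x \<and>
      (\<forall>\<theta>'\<in>admissible_targets \<mu> \<nu> x. \<theta>' \<preceq>\<^sub>s\<^sub>t \<theta> \<longrightarrow> \<theta>' = \<theta>)"
    using \<theta> by blast
qed (use assms in metis)

text \<open>
  The sets \<open>(x, \<infinity>) \<times> B\<close> are closed under intersection and generate the Borel sets of the plane, so
  at most one measure has the prescribed tails.
\<close>

lemma P_star_eqI:
  assumes P: "directional_coupling \<mu> \<nu> P"
    and tail: "\<And>x B. B \<in> sets borel \<Longrightarrow> emeasure P ({x<..} \<times> B) = emeasure (optimal_target \<mu> \<nu> x) B"
  shows "P_star \<mu> \<nu> = P"
  unfolding P_star_def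
proof (rule the_equality)
  fix Q assume Q: "directional_coupling \<mu> \<nu> Q \<and>
    (\<forall>x. \<forall>B\<in>sets borel. emeasure Q ({x<..} \<times> B) = emeasure (optimal_target \<mu> \<nu> x) B)"
  define E where "E = {{x::real<..} \<times> B | x (B :: real set). B \<in> sets borel}"
  have sets_E: "sets (borel :: (real \<times> real) measure) = sigma_sets UNIV E"
  proof -
    have "sets (borel :: (real \<times> real) measure) = sets ((borel :: real measure) \<Otimes>\<^sub>M (borel :: real measure))"
      unfolding borel_prod ..
    also have "\<dots> = sets (sigma (space borel \<times> space borel)
        {a \<times> b |a b. a \<in> range greaterThan \<and> b \<in> sets (borel :: real measure)})"
    proof (rule sets_pair_eq[where Ca="range (\<lambda>n::nat. {- real n<..})" and Cb="{UNIV}"])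
      show "sets (borel :: real measure) = sigma_sets (space borel) (range greaterThan)"
        by (subst borel_Ioi) (simp add: sets_measure_of)
      show "\<Union> (range (\<lambda>n::nat. {- real n<..})) = space borel"
        by auto (metis minus_less_iff reals_Archimedean2)
      show "sets (borel :: real measure) = sigma_sets (space borel) (sets borel)"
        by (metis sets.sigma_sets_eq)
    qed auto
    also have "\<dots> = sigma_sets UNIV E"
    proof -
      have "{a \<times> b |a b. a \<in> range greaterThan \<and> b \<in> sets (borel :: real measure)} = E"
        unfolding E_def by blast
      then show ?thesis by (simp add: sets_measure_of)
    qed
    finally show ?thesis .
  qed
  have sets_eq: "sets P = sets borel" "sets Q = sets borel"
    using P Q by (auto simp: directional_coupling_def coupling_def)
  interpret Q: prob_space Q
    using Q by (auto simp: directional_coupling_def coupling_def)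
  show "Q = P"
  proof (rule measure_eqI_generator_eq[where \<Omega>=UNIV and E=E and A="\<lambda>n. {- real n<..} \<times> UNIV"])
    show "Int_stable E"
    proof (rule Int_stableI)
      fix X Y assume "X \<in> E" "Y \<in> E"
      then obtain x y B C where "X = {x<..} \<times> B" "Y = {y<..} \<times> C" "B \<in> sets borel" "C \<in> sets borel"
        unfolding E_def by blast
      then have "X \<inter> Y = {max x y<..} \<times> (B \<inter> C)" "B \<inter> C \<in> sets borel" by auto
      then show "X \<inter> Y \<in> E" unfolding E_def by blast
    qed
    show "(\<Union>n::nat. {- real n<..} \<times> UNIV) = (UNIV :: (real \<times> real) set)"
      by auto (metis minus_less_iff reals_Archimedean2)
    show "emeasure Q X = emeasure P X" if "X \<in> E" for X
      using that Q tail unfolding E_def by auto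
    have "{- real n<..} \<times> UNIV \<in> E" for n
      unfolding E_def by (intro CollectI exI[of _ "- real n"] exI[of _ UNIV]) simp
    then show "range (\<lambda>n. {- real n<..} \<times> UNIV) \<subseteq> E" by auto
  qed (use sets_eq sets_E in auto)
qed (use assms in blast)

section \<open>The mass still travelling at a given point\<close>

locale singular_st_pair = M: real_distribution \<mu> + N: real_distribution \<nu>
  for \<mu> \<nu> :: "real measure" +
  assumes atomless_\<mu>: "atomless \<mu>" and atomless_\<nu>: "atomless \<nu>"
    and st_le: "\<mu> \<preceq>\<^sub>s\<^sub>t \<nu>"
    and singular: "inf \<mu> \<nu> = null_measure borel"
begin

abbreviation "F \<equiv> cdf_diff \<mu> \<nu>"
abbreviation "A \<equiv> future_minima F"
abbreviation "T \<equiv> transport_map F"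

lemma measure_singleton: "measure \<mu> {x} = 0" "measure \<nu> {x} = 0"
  using atomless_\<mu> atomless_\<nu> by (auto simp: atomless_def measure_def)

lemma isCont_cdfs: "isCont (cdf \<mu>) x" "isCont (cdf \<nu>) x"
  by (simp_all add: M.isCont_cdf N.isCont_cdf measure_singleton)

lemma continuous_F: "continuous_on UNIV F"
  unfolding cdf_diff_def[abs_def]
  by (intro continuous_at_imp_continuous_on ballI continuous_intros isCont_cdfs)

lemma F_nonneg: "0 \<le> F x"
  using st_le by (simp add: st_le_def cdf_diff_def)

lemma run_min_nonneg: "x \<le> y \<Longrightarrow> 0 \<le> run_min F x y"
  using run_min_attained[OF continuous_F] F_nonneg by metis

lemma closed_A: "closed (A y)"
  by (rule closed_future_minima[OF continuous_F])

lemma A_borel [measurable, simp]: "A y \<in> sets borel"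
  by (rule borel_closed[OF closed_A])

lemma T_borel [measurable]: "T \<in> borel_measurable borel"
  by (rule measurable_transport_map[OF continuous_F])

lemma null_singleton: "{x} \<in> null_sets \<mu>" "{x} \<in> null_sets \<nu>"
  using atomless_\<mu> atomless_\<nu> by (auto simp: atomless_def intro!: null_setsI)

lemma measure_Int_Ioc_eq_Icc:
  assumes "B \<in> sets borel"
  shows "measure \<mu> (B \<inter> {s<..t}) = measure \<mu> (B \<inter> {s..t})"
    and "measure \<nu> (B \<inter> {s<..t}) = measure \<nu> (B \<inter> {s..t})"
proof -
  have "B \<inter> {s<..t} = B \<inter> {s..t} - {s}" by auto
  then show "measure \<mu> (B \<inter> {s<..t}) = measure \<mu> (B \<inter> {s..t})"
    "measure \<nu> (B \<inter> {s<..t}) = measure \<nu> (B \<inter> {s..t})"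
    using assms by (simp_all add: measure_Diff_null_set null_singleton)
qed

lemma measure_Icc:
  assumes "s \<le> t"
  shows "measure \<mu> {s..t} = cdf \<mu> t - cdf \<mu> s" "measure \<nu> {s..t} = cdf \<nu> t - cdf \<nu> s"
  using measure_Int_Ioc_eq_Icc[of UNIV s t] M.cdf_diff_eq[of s t] N.cdf_diff_eq[of s t] assms
  by (cases "s = t"; simp add: measure_singleton)+

lemma measure_Ioo:
  assumes "s < t"
  shows "measure \<mu> {s<..<t} = cdf \<mu> t - cdf \<mu> s" "measure \<nu> {s<..<t} = cdf \<nu> t - cdf \<nu> s"
proof -
  have "{s<..<t} = {s<..t} - {t}" by auto
  then show "measure \<mu> {s<..<t} = cdf \<mu> t - cdf \<mu> s" "measure \<nu> {s<..<t} = cdf \<nu> t - cdf \<nu> s"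
    using M.cdf_diff_eq[OF assms] N.cdf_diff_eq[OF assms]
    by (simp_all add: measure_Diff_null_set null_singleton)
qed

lemma extremal_future_minima:
  assumes "A y \<inter> {s..t} \<noteq> {}"
  shows "Sup (A y \<inter> {s..t}) \<in> A y \<inter> {s..t}" "Inf (A y \<inter> {s..t}) \<in> A y \<inter> {s..t}"
proof -
  have "closed (A y \<inter> {s..t})" by (intro closed_Int closed_A closed_atLeastAtMost)
  then show "Sup (A y \<inter> {s..t}) \<in> A y \<inter> {s..t}" "Inf (A y \<inter> {s..t}) \<in> A y \<inter> {s..t}"
    using assms by (intro closed_contains_Sup closed_contains_Inf; simp)+
qed

text \<open>
  Between the extreme points of \<open>B\<close>, the charge \<open>\<mu> - \<nu>\<close> of the whole interval is the increment of
  \<open>F\<close>, and the gaps of \<open>B\<close> contribute nothing.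
\<close>

lemma charge_of_future_minima:
  fixes y s t :: real
  defines "B \<equiv> A y \<inter> {s..t}"
  assumes "B \<noteq> {}"
  shows "measure \<mu> B - measure \<nu> B = F (Sup B) - F (Inf B)"
proof -
  have S: "Sup B \<in> B" and I: "Inf B \<in> B"
    using extremal_future_minima assms(2) unfolding B_def by blast+
  have bounds: "Inf B \<le> p" "p \<le> Sup B" if "p \<in> B" for p
    using that by (auto simp: B_def intro!: cInf_lower cSup_upper)
  have IS: "Inf B \<le> Sup B" using S bounds by blast
  have "B \<subseteq> {Inf B..Sup B} \<inter> A y"
    using bounds by (auto simp: B_def)
  moreover have "{Inf B..Sup B} \<inter> A y \<subseteq> B"
    using S I unfolding B_def by auto
  ultimately have B_eq: "B = {Inf B..Sup B} - ({Inf B..Sup B} - A y)" by blast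
  have "emeasure \<mu> ({Inf B..Sup B} - A y) = emeasure \<nu> ({Inf B..Sup B} - A y)"
  proof (rule emeasure_gaps_eq[OF _ _ closed_A])
    fix a b assume "a \<in> A y" "b \<in> A y" "a < b" "{a<..<b} \<inter> A y = {}"
    then have "F a = F b" by (intro gap_endpoints_eq[OF continuous_F])
    then have "cdf \<mu> b - cdf \<mu> a = cdf \<nu> b - cdf \<nu> a" by (simp add: cdf_diff_def)
    then show "emeasure \<mu> {a<..<b} = emeasure \<nu> {a<..<b}"
      using \<open>a < b\<close> by (simp add: M.emeasure_eq_measure N.emeasure_eq_measure measure_Ioo)
  qed (use S I in \<open>auto simp: B_def\<close>)
  then have "measure \<mu> ({Inf B..Sup B} - A y) = measure \<nu> ({Inf B..Sup B} - A y)"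
    by (simp add: measure_def)
  moreover have "measure \<mu> B = measure \<mu> {Inf B..Sup B} - measure \<mu> ({Inf B..Sup B} - A y)"
    by (subst B_eq, subst M.finite_measure_Diff) auto
  moreover have "measure \<nu> B = measure \<nu> {Inf B..Sup B} - measure \<nu> ({Inf B..Sup B} - A y)"
    by (subst B_eq, subst N.finite_measure_Diff) auto
  ultimately show ?thesis
    using IS by (simp add: measure_Icc cdf_diff_def)
qed

text \<open>
  Along \<open>A y\<close> the function \<open>F\<close> is nondecreasing, so the charge of every \<open>A y \<inter> [s, t]\<close> is nonnegative.
  Hence the part of \<open>\<nu>\<close> on \<open>A y\<close> lies below both \<open>\<nu>\<close> and \<open>\<mu>\<close>, and singularity kills it.
\<close>

lemma nu_future_minima: "measure \<nu> (A y) = 0"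
proof -
  have "restrict_to \<nu> (A y) \<le> restrict_to \<mu> (A y)"
  proof (rule le_measure_if_Ioc_le)
    fix s t :: real
    let ?B = "A y \<inter> {s..t}"
    have "measure \<nu> ?B \<le> measure \<mu> ?B"
    proof (cases "?B = {}")
      case False
      have "Inf ?B \<le> Sup ?B" using False by (intro cInf_le_cSup) auto
      with extremal_future_minima[OF False] have "F (Inf ?B) \<le> F (Sup ?B)" by (simp add: future_minima_def)
      then show ?thesis using charge_of_future_minima[OF False] by simp
    qed simp
    then show "measure (restrict_to \<nu> (A y)) {s<..t} \<le> measure (restrict_to \<mu> (A y)) {s<..t}"
      by (simp add: measure_restrict_to measure_Int_Ioc_eq_Icc)
  qed (auto intro!: finite_borel_measure_restrict_to M.finite_borel_measure_M N.finite_borel_measure_M)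
  also have "restrict_to \<mu> (A y) \<le> \<mu>" by (simp add: restrict_to_le)
  finally have "restrict_to \<nu> (A y) \<le> null_measure borel"
    unfolding singular[symmetric] by (simp add: restrict_to_le)
  then have "emeasure (restrict_to \<nu> (A y)) UNIV \<le> 0"
    by (subst (asm) borel_measure_le_iff) (auto dest!: bspec[of _ _ UNIV])
  then show ?thesis by (simp add: emeasure_restrict_to measure_def)
qed

text \<open>
  As \<open>\<nu>\<close> does not charge \<open>A y\<close>, the mass under \<open>\<mu>\<close> is the increment of \<open>F\<close> from the first future
  minimum after \<open>x\<close>, where \<open>F\<close> has its minimum over \<open>[x, y]\<close>, to the last one, which is \<open>y\<close>.
\<close>

lemma mu_future_minima:
  assumes "x \<le> y"
  shows "measure \<mu> (A y \<inter> {x..y}) = F y - run_min F x y"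
proof -
  let ?B = "A y \<inter> {x..y}"
  have y: "y \<in> ?B" using assms by (auto simp: future_minima_def)
  then have I: "Inf ?B \<in> ?B" by (intro extremal_future_minima(2)) blast
  have "Sup ?B = y" using y by (intro cSup_eq_maximum) auto
  moreover have "run_min F x y = F (Inf ?B)"
  proof (rule run_min_eq_first_future_minimum[OF continuous_F])
    have "Inf ?B \<le> p" if "p \<in> ?B" for p using that by (rule cInf_lower) simp
    then show "{x..<Inf ?B} \<inter> A y = {}" using I by (fastforce simp: disjoint_iff)
  qed (use I in auto)
  moreover have "measure \<nu> ?B \<le> measure \<nu> (A y)"
    by (intro N.finite_measure_mono) auto
  then have "measure \<nu> ?B = 0"
    using nu_future_minima measure_nonneg[of \<nu> ?B] by simp
  moreover have "?B \<noteq> {}" using y by blast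
  ultimately show ?thesis using charge_of_future_minima[of y x y] by simp
qed

text \<open>
  Of the mass starting after \<open>x\<close>, the part that ends at \<open>y\<close> or later either starts after \<open>y\<close> or is
  travelling at \<open>y\<close>.
\<close>

lemma measure_T_ge:
  assumes "x \<le> y"
  shows "measure \<mu> {t. x < t \<and> ereal y \<le> T t} = 1 - cdf \<nu> y - run_min F x y"
proof -
  have "{t. x < t \<and> ereal y \<le> T t} = A y \<inter> {x<..y} \<union> {y<..}"
    using assms by (auto simp: le_transport_map_iff[OF continuous_F] future_minima_def)
  then have "measure \<mu> {t. x < t \<and> ereal y \<le> T t} = measure \<mu> (A y \<inter> {x<..y}) + measure \<mu> {y<..}"
    by (simp add: M.finite_measure_Union disjoint_iff)
  also have "measure \<mu> (A y \<inter> {x<..y}) = F y - run_min F x y"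
    using assms by (simp add: measure_Int_Ioc_eq_Icc mu_future_minima)
  also have "measure \<mu> {y<..} = 1 - cdf \<mu> y"
    using M.prob_compl[of "{..y}"] by (simp add: cdf_def Compl_eq_Diff_UNIV[symmetric])
  finally show ?thesis
    by (simp add: cdf_diff_def[of \<mu> \<nu> y])
qed

text \<open>
  Mass sent to infinity is travelling at every \<open>y\<close>, so it is at most \<open>1 - F\<^sub>\<nu> y\<close>, which tends to zero.
\<close>

lemma AE_T_finite: "AE t in \<mu>. T t \<noteq> \<infinity>"
proof -
  have "AE t in \<mu>. x < t \<longrightarrow> T t \<noteq> \<infinity>" for x
  proof -
    have "measure \<mu> {t. x < t \<and> T t = \<infinity>} \<le> 1 - cdf \<nu> y" if "x \<le> y" for y
    proof -
      have "measure \<mu> {t. x < t \<and> T t = \<infinity>} \<le> measure \<mu> {t. x < t \<and> ereal y \<le> T t}"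
        by (intro M.finite_measure_mono) auto
      also have "\<dots> \<le> 1 - cdf \<nu> y"
        using that run_min_nonneg by (simp add: measure_T_ge)
      finally show ?thesis .
    qed
    then have "\<forall>\<^sub>F y in at_top. measure \<mu> {t. x < t \<and> T t = \<infinity>} \<le> 1 - cdf \<nu> y"
      by (auto simp: eventually_at_top_linorder)
    moreover have "((\<lambda>y. 1 - cdf \<nu> y) \<longlongrightarrow> 0) at_top"
      using tendsto_diff[OF tendsto_const N.cdf_lim_at_top_prob, of 1] by simp
    ultimately have "measure \<mu> {t. x < t \<and> T t = \<infinity>} \<le> 0"
      by (intro tendsto_lowerbound) auto
    then have "emeasure \<mu> {t. x < t \<and> T t = \<infinity>} = 0"
      unfolding M.emeasure_eq_measure by (rule ennreal_neg)
    then show ?thesis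
      by (intro AE_I[of _ _ "{t. x < t \<and> T t = \<infinity>}"]) auto
  qed
  then have "AE t in \<mu>. \<forall>n::nat. - real n < t \<longrightarrow> T t \<noteq> \<infinity>"
    unfolding AE_all_countable by blast
  then show ?thesis
    by eventually_elim (metis minus_less_iff reals_Archimedean2)
qed

section \<open>Transported tails are the optimal targets\<close>

text \<open>
  A real-valued version of \<open>T\<close>; the value \<open>0\<close> that it takes where \<open>T\<close> is infinite concerns only a
  \<open>\<mu>\<close>-null set.
\<close>

definition S :: "real \<Rightarrow> real" where
  "S t = real_of_ereal (T t)"

lemma S_borel [measurable]: "S \<in> borel_measurable borel"
  unfolding S_def[abs_def] by measurable

lemma AE_T_eq_S: "AE t in \<mu>. T t = ereal (S t)"
  using AE_T_finite
proof eventually_elim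
  case (elim t)
  moreover have "T t \<noteq> -\<infinity>" using transport_map_ge[of t F] by auto
  ultimately show ?case by (cases "T t") (simp_all add: S_def)
qed

lemma AE_le_S: "AE t in \<mu>. t \<le> S t"
  using AE_T_eq_S by eventually_elim (metis ereal_less_eq(3) transport_map_ge)

definition target :: "real \<Rightarrow> real measure" where
  "target x = distr (restrict_to \<mu> {x<..}) borel S"

lemma sets_target [simp, measurable_cong]: "sets (target x) = sets borel"
  by (simp add: target_def)

lemma space_target [simp]: "space (target x) = UNIV"
  by (simp add: target_def)

lemma emeasure_target:
  assumes [measurable]: "B \<in> sets borel"
  shows "emeasure (target x) B = emeasure \<mu> {t. x < t \<and> S t \<in> B}"
proof -
  have "S -` B \<in> sets borel" by (rule measurable_sets_borel[OF S_borel assms])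
  then have "emeasure (target x) B = emeasure \<mu> ({x<..} \<inter> S -` B)"
    unfolding target_def by (simp add: emeasure_distr emeasure_restrict_to)
  also have "{x<..} \<inter> S -` B = {t. x < t \<and> S t \<in> B}" by auto
  finally show ?thesis .
qed

lemma finite_borel_measure_target: "finite_borel_measure (target x)"
  by (rule finite_borel_measureI) (simp_all add: emeasure_target M.emeasure_eq_measure)

lemma measure_target:
  assumes "B \<in> sets borel"
  shows "measure (target x) B = measure \<mu> {t. x < t \<and> S t \<in> B}"
  using emeasure_target[OF assms] by (simp add: measure_def)

text \<open>
  The maximum covers the case \<open>y < x\<close>, in which all the mass counts because nothing moves to the left.
\<close>

lemma measure_target_atLeast:
  "measure (target x) {y..} = 1 - cdf \<nu> (max x y) - run_min F x (max x y)"
proof -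
  have "measure (target x) {y..} = measure \<mu> {t. x < t \<and> y \<le> S t}"
    by (simp add: measure_target)
  also have "\<dots> = measure \<mu> {t. x < t \<and> ereal (max x y) \<le> T t}"
  proof (rule M.finite_measure_eq_AE)
    show "AE t in \<mu>. t \<in> {t. x < t \<and> y \<le> S t} \<longleftrightarrow> t \<in> {t. x < t \<and> ereal (max x y) \<le> T t}"
      using AE_T_eq_S AE_le_S by eventually_elim auto
  qed auto
  also have "\<dots> = 1 - cdf \<nu> (max x y) - run_min F x (max x y)"
    by (rule measure_T_ge) simp
  finally show ?thesis .
qed

lemma measure_target_UNIV: "measure (target x) UNIV = 1 - cdf \<mu> x"
  using M.prob_compl[of "{..x}"]
  by (simp add: measure_target cdf_def Compl_eq_Diff_UNIV[symmetric] greaterThan_def not_le)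

text \<open>
  The minimum of \<open>F\<close> over \<open>[x, y]\<close> is nonincreasing in \<open>y\<close>, so an interval \<open>[s, u)\<close> receives at most
  \<open>F\<^sub>\<nu> u - F\<^sub>\<nu> s\<close>.  The tail formula speaks of closed half-lines, whence the limit \<open>u \<down> t\<close> for the
  interval \<open>(s, t]\<close>.
\<close>

lemma target_le: "target x \<le> \<nu>"
proof (rule le_measure_if_Ioc_le[OF N.finite_borel_measure_M finite_borel_measure_target])
  interpret target: finite_borel_measure "target x" by (rule finite_borel_measure_target)
  fix s t :: real assume "s < t"
  have *: "measure (target x) {s<..t} \<le> cdf \<nu> u - cdf \<nu> s" if "t < u" for u
  proof -
    have "measure (target x) {s<..t} \<le> measure (target x) ({s..} - {u..})"
      using that by (intro target.finite_measure_mono) auto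
    also have "\<dots> = measure (target x) {s..} - measure (target x) {u..}"
      using \<open>s < t\<close> that by (intro target.finite_measure_Diff) auto
    also have "\<dots> \<le> cdf \<nu> (max x u) - cdf \<nu> (max x s)"
      using run_min_antimono[OF continuous_F, of x "max x s" "max x u"] \<open>s < t\<close> that
      by (simp add: measure_target_atLeast)
    also have "\<dots> \<le> cdf \<nu> u - cdf \<nu> s"
      using \<open>s < t\<close> that N.cdf_nondecreasing[of s x] N.cdf_nondecreasing[of s u] by (auto simp: max_def)
    finally show ?thesis .
  qed
  have "measure (target x) {s<..t} \<le> cdf \<nu> t - cdf \<nu> s"
  proof (rule tendsto_lowerbound)
    show "((\<lambda>u. cdf \<nu> u - cdf \<nu> s) \<longlongrightarrow> cdf \<nu> t - cdf \<nu> s) (at_right t)"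
      using N.cdf_is_right_cont[of t] by (intro tendsto_intros) (simp add: continuous_within)
    show "\<forall>\<^sub>F u in at_right t. measure (target x) {s<..t} \<le> cdf \<nu> u - cdf \<nu> s"
      by (rule eventually_at_rightI[of t "t + 1"]) (auto intro: *)
  qed simp
  then show "measure (target x) {s<..t} \<le> measure \<nu> {s<..t}"
    using N.cdf_diff_eq[OF \<open>s < t\<close>] by simp
qed

lemma cdf_restrict_to_Ioi:
  "cdf (restrict_to \<mu> {x<..}) y = (if x \<le> y then cdf \<mu> y - cdf \<mu> x else 0)"
proof -
  have "cdf (restrict_to \<mu> {x<..}) y = measure \<mu> {x<..y}"
    by (simp add: cdf_def2 measure_restrict_to) (rule arg_cong[of _ _ "measure \<mu>"], auto)
  then show ?thesis using M.cdf_diff_eq[of x y] by (cases "x < y") auto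
qed

lemma target_admissible: "target x \<in> admissible_targets \<mu> \<nu> x"
proof -
  have "emeasure (restrict_to \<mu> {x<..}) UNIV = emeasure (target x) UNIV"
    by (simp add: emeasure_target emeasure_restrict_to greaterThan_def)
  moreover have "cdf (target x) y \<le> cdf (restrict_to \<mu> {x<..}) y" for y
  proof -
    have "cdf (target x) y = measure \<mu> {t. x < t \<and> S t \<le> y}"
      by (simp add: cdf_def2 measure_target)
    also have "\<dots> \<le> measure \<mu> ({x<..} \<inter> {..y})"
      using AE_le_S by (intro M.finite_measure_mono_AE) (auto elim!: eventually_mono)
    finally show ?thesis by (simp add: cdf_def2 measure_restrict_to)
  qed
  ultimately show ?thesis
    by (simp add: admissible_targets_def st_le_def target_le finite_borel_measure_target)
qed

text \<open>
  Split \<open>(x, y]\<close> at a minimiser \<open>p\<close> of \<open>F\<close>: before \<open>p\<close> a competitor receives at most what \<open>\<mu>\<close> has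
  sent out, after \<open>p\<close> at most what \<open>\<nu>\<close> admits, and the sum is exactly what the target receives in
  \<open>(-\<infinity>, y)\<close>.
\<close>

lemma target_least:
  assumes "\<theta> \<in> admissible_targets \<mu> \<nu> x"
  shows "target x \<preceq>\<^sub>s\<^sub>t \<theta>"
proof -
  from assms interpret \<theta>: finite_borel_measure \<theta> by (simp add: admissible_targets_def)
  interpret target: finite_borel_measure "target x" by (rule finite_borel_measure_target)
  have tot: "emeasure (restrict_to \<mu> {x<..}) UNIV = emeasure \<theta> UNIV"
    and cdf: "\<And>y. cdf \<theta> y \<le> cdf (restrict_to \<mu> {x<..}) y" and "\<theta> \<le> \<nu>"
    using assms by (auto simp: admissible_targets_def st_le_def)
  have "cdf \<theta> y \<le> cdf (target x) y" for y
  proof (cases "x \<le> y")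
    case True
    then obtain p where p: "p \<in> {x..y}" "run_min F x y = F p"
      using run_min_attained[OF continuous_F] by blast
    have "emeasure \<theta> {p<..y} \<le> emeasure \<nu> {p<..y}"
      using \<open>\<theta> \<le> \<nu>\<close> by (simp add: borel_measure_le_iff \<theta>.M_is_borel)
    then have "cdf \<theta> y - cdf \<theta> p \<le> cdf \<nu> y - cdf \<nu> p"
      using p N.cdf_nondecreasing[of p y] by (simp add: \<theta>.emeasure_Ioc N.emeasure_Ioc ennreal_le_iff)
    moreover have "cdf \<theta> p \<le> cdf \<mu> p - cdf \<mu> x"
      using cdf[of p] p by (simp add: cdf_restrict_to_Ioi)
    ultimately have "cdf \<theta> y \<le> cdf \<nu> y - cdf \<mu> x + run_min F x y"
      using p by (simp add: cdf_diff_def)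
    also have "\<dots> = measure (target x) (UNIV - {y..})"
      using True target.finite_measure_compl[of "{y..}"]
      by (simp add: measure_target_atLeast measure_target_UNIV)
    also have "\<dots> \<le> cdf (target x) y"
      unfolding cdf_def by (intro target.finite_measure_mono) auto
    finally show ?thesis .
  next
    case False
    then show ?thesis using cdf[of y] target.cdf_nonneg[of y] by (simp add: cdf_restrict_to_Ioi)
  qed
  moreover have "emeasure (target x) UNIV = emeasure \<theta> UNIV"
    using target_admissible[of x] tot by (simp add: admissible_targets_def st_le_def)
  ultimately show ?thesis by (simp add: st_le_def)
qed

lemma optimal_target_eq: "optimal_target \<mu> \<nu> x = target x"
  by (intro optimal_target_eqI target_admissible target_least)

text \<open>
  Letting \<open>x\<close> tend to \<open>-\<infinity>\<close> in \<open>target_le\<close> bounds the image of \<open>\<mu>\<close> by \<open>\<nu>\<close>; two probability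
  measures that are ordered are equal, by passing to complements.
\<close>

lemma distr_S: "distr \<mu> borel S = \<nu>"
proof -
  interpret D: prob_space "distr \<mu> borel S" by (intro M.prob_space_distr) simp
  have le: "measure (distr \<mu> borel S) B \<le> measure \<nu> B" if [measurable]: "B \<in> sets borel" for B
  proof -
    have "(\<lambda>n. measure \<mu> {t. - real n < t \<and> S t \<in> B}) \<longlonglongrightarrow> measure \<mu> (\<Union>n::nat. {t. - real n < t \<and> S t \<in> B})"
      by (intro M.finite_Lim_measure_incseq) (auto simp: incseq_def)
    also have "(\<Union>n::nat. {t. - real n < t \<and> S t \<in> B}) = S -` B"
      by auto (metis minus_less_iff reals_Archimedean2)
    also have "measure \<mu> (S -` B) = measure (distr \<mu> borel S) B"
      by (simp add: measure_distr)
    finally show ?thesis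
    proof (rule tendsto_upperbound)
      have "emeasure (target x) B \<le> emeasure \<nu> B" for x
        using target_le by (simp add: borel_measure_le_iff)
      then have "measure (target x) B \<le> measure \<nu> B" for x
        by (simp add: N.emeasure_eq_measure finite_measure.emeasure_eq_measure
            finite_borel_measure.axioms(1)[OF finite_borel_measure_target])
      then show "\<forall>\<^sub>F n in sequentially. measure \<mu> {t. - real n < t \<and> S t \<in> B} \<le> measure \<nu> B"
        by (simp add: measure_target)
    qed simp
  qed
  show ?thesis
  proof (rule measure_eqI)
    fix B assume "B \<in> sets (distr \<mu> borel S)"
    then have B: "B \<in> sets borel" by simp
    then have "measure (distr \<mu> borel S) (UNIV - B) \<le> measure \<nu> (UNIV - B)" by (intro le) auto
    then have "measure (distr \<mu> borel S) B = measure \<nu> B"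
      using le[OF B] B D.prob_compl[of B] N.prob_compl[of B] by simp
    then show "emeasure (distr \<mu> borel S) B = emeasure \<nu> B"
      by (simp add: D.emeasure_eq_measure N.emeasure_eq_measure)
  qed simp
qed

section \<open>The optimal coupling\<close>

lemma directional_coupling_graph: "directional_coupling \<mu> \<nu> (distr \<mu> borel (\<lambda>t. (t, S t)))"
proof -
  have m [measurable]: "(\<lambda>t. (t, S t)) \<in> borel_measurable \<mu>"
    by (simp add: borel_prod[symmetric])
  have [measurable]: "fst \<in> borel_measurable (borel :: (real \<times> real) measure)"
    "snd \<in> borel_measurable (borel :: (real \<times> real) measure)"
    by (simp_all add: borel_prod[symmetric])
  have "prob_space (distr \<mu> borel (\<lambda>t. (t, S t)))"
    by (rule M.prob_space_distr[OF m])
  moreover have "distr (distr \<mu> borel (\<lambda>t. (t, S t))) borel fst = \<mu>"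
    by (simp add: distr_distr comp_def distr_id2)
  moreover have "distr (distr \<mu> borel (\<lambda>t. (t, S t))) borel snd = \<nu>"
    by (simp add: distr_distr comp_def distr_S)
  moreover have "AE (x, y) in distr \<mu> borel (\<lambda>t. (t, S t)). y \<ge> x"
  proof (subst AE_distr_iff[OF m])
    show "{p \<in> space borel. case p of (x, y) \<Rightarrow> y \<ge> x} \<in> sets (borel :: (real \<times> real) measure)"
      by (simp add: borel_prod[symmetric])
  qed (use AE_le_S in simp)
  ultimately show ?thesis by (simp add: directional_coupling_def coupling_def)
qed

lemma P_star_eq: "P_star \<mu> \<nu> = distr \<mu> borel (\<lambda>t. (t, S t))"
proof (rule P_star_eqI[OF directional_coupling_graph])
  fix x and B :: "real set" assume B: "B \<in> sets borel"
  have m: "(\<lambda>t. (t, S t)) \<in> borel_measurable \<mu>"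
    by (simp add: borel_prod[symmetric])
  have "emeasure (distr \<mu> borel (\<lambda>t. (t, S t))) ({x<..} \<times> B) = emeasure \<mu> ((\<lambda>t. (t, S t)) -` ({x<..} \<times> B))"
    using B by (subst emeasure_distr[OF m]) (auto simp: borel_prod[symmetric])
  also have "(\<lambda>t. (t, S t)) -` ({x<..} \<times> B) = {t. x < t \<and> S t \<in> B}" by auto
  finally show "emeasure (distr \<mu> borel (\<lambda>t. (t, S t))) ({x<..} \<times> B) = emeasure (optimal_target \<mu> \<nu> x) B"
    using B by (simp add: optimal_target_eq emeasure_target)
qed

end

lemma kernel_product_return:
  assumes "sets \<mu> = sets borel" "space \<mu> \<noteq> {}" and S [measurable]: "S \<in> borel_measurable borel"
  shows "kernel_product \<mu> (\<lambda>x. return borel (S x)) = distr \<mu> borel (\<lambda>x. (x, S x))"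
proof -
  have [measurable_cong]: "sets \<mu> = sets borel" by fact
  have "distr (return borel (S x)) borel (Pair x) = return borel (x, S x)" for x
    by (intro distr_return) (auto simp: borel_prod[symmetric])
  then show ?thesis
    unfolding kernel_product_def
    using assms by (simp add: bind_return_distr' borel_prod[symmetric])
qed

theorem theorem2p8:
  fixes \<mu> \<nu> :: "real measure"
  assumes "real_distribution \<mu>" and "real_distribution \<nu>"
    and "atomless \<mu>" and "atomless \<nu>"
    and "\<mu> \<preceq>\<^sub>s\<^sub>t \<nu>"
    and "inf \<mu> \<nu> = null_measure borel"
  shows "monge_type \<mu> \<nu> (P_star \<mu> \<nu>) (transport_map (cdf_diff \<mu> \<nu>))"
proof -
  interpret singular_st_pair \<mu> \<nu>
    using assms by (simp add: singular_st_pair_def singular_st_pair_axioms_def)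
  have "coupling \<mu> \<nu> (P_star \<mu> \<nu>)"
    using directional_coupling_graph by (simp add: P_star_eq directional_coupling_def)
  moreover have "(\<lambda>x. return borel (S x)) \<in> borel \<rightarrow>\<^sub>M prob_algebra borel"
    by measurable
  moreover have "P_star \<mu> \<nu> = kernel_product \<mu> (\<lambda>x. return borel (S x))"
    by (simp add: P_star_eq kernel_product_return)
  moreover have "AE x in \<mu>. \<exists>y. T x = ereal y \<and> return borel (S x) = return borel y"
    using AE_T_eq_S by eventually_elim blast
  ultimately show ?thesis
    unfolding monge_type_def by (intro conjI bexI[of _ "\<lambda>x. return borel (S x)"])
qed

end
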